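(* Let $s\neq 0$ be a real number, let $A\in \mathrm{SL}_2(\mathbb{Z})$ be a matrix with eigenvalues $\lambda=\pm e^{s}$ and $\lambda^{-1}$, and let $P\in\mathrm{GL}_2(\mathbb{R})$ be such that $PAP^{-1}=\begin{pmatrix}\lambda&0\\0&\lambda^{-1}\end{pmatrix}$ and $P_{11}=P_{22}=1$. Let $\Gamma=\Gamma(A)=\{(P(p,q),sr)\mid p,q,r\in\mathbb{Z}\}$ be the corresponding lattice in $Sol$. Let $g_1,g_2\in Sol$, and let $m_1=g_1\Gamma$, $m_2=g_2\Gamma\in Sol/\Gamma$. If $g_1^{-1}g_2=(x,y,z)$ satisfies either $x=0$ and $y\neq0$, or $y=0$ and $x\neq0$, then the pair $m_1,m_2$ is not blockable.
   Context: $Sol$ is the Lie group $\mathbb{R}^2\rtimes\mathbb{R}$, i.e. $\mathbb{R}^3$ with multiplication $(x_1,y_1,z_1)(x_2,y_2,z_2)=(x_1+e^{z_1}x_2,\;y_1+e^{-z_1}y_2,\;z_1+z_2)$. Elements of $\mathbb{R}^2$ are treated as column vectors, so $P(p,q)$ denotes the matrix $P$ applied to the column vector $(p,q)^T$, and $(P(p,q),sr)$ is a point of $\mathbb{R}^2\times\mathbb{R}=Sol$. Blocking: Let $G$ be a connected Lie group with Lie algebra $\mathfrak{G}$ and exponential map $\exp:\mathfrak{G}\to G$, let $\Gamma\subset G$ be a lattice, and let $M=G/\Gamma$ (left cosets $g\Gamma$, with $G$ acting by left multiplication, $g\cdot m$). For $m_1,m_2\in M$ (not necessarily distinct), a connecting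 curve for the pair is a parametrized curve $c(t)=\exp(tx)\cdot m_1$, $0\le t\le 1$, with $x\in\mathfrak{G}$, such that $c(0)=m_1$ and $c(1)=m_2$. A finite set $B\subset M\setminus\{m_1,m_2\}$ is a blocking set for the pair $m_1,m_2$ if $c([0,1])\cap B\ne\emptyset$ for every connecting curve $c$ of the pair. The pair is blockable if a (finite) blocking set exists. *)

theory Defs
  imports "HOL-Analysis.Analysis" "HOL-Algebra.Left_Coset"
begin

section \<open>Blocking in homogeneous spaces of Lie groups\<close>

text \<open>
  We consider Lie groups whose underlying manifold is a single real vector space (one global
  chart), so that the Lie algebra, as a vector space, is that same space, viewed as the tangent
  space at the identity. A differentiable homomorphism from the real line is automatically smooth.
\<close>

definition one_parameter_subgroup ::
    "('a::real_normed_vector, 'b) monoid_scheme \<Rightarrow> (real \<Rightarrow> 'a) \<Rightarrow> bool" where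
  "one_parameter_subgroup G \<gamma> \<longleftrightarrow>
     range \<gamma> \<subseteq> carrier G \<and> (\<forall>t u. \<gamma> (t + u) = \<gamma> t \<otimes>\<^bsub>G\<^esub> \<gamma> u) \<and> \<gamma> differentiable_on UNIV"

text \<open>The exponential map sends \<open>v\<close> to \<open>\<gamma> 1\<close>, where \<open>\<gamma>\<close> is the one-parameter subgroup with
  initial velocity \<open>v\<close>.\<close>

definition lie_exp :: "('a::real_normed_vector, 'b) monoid_scheme \<Rightarrow> 'a \<Rightarrow> 'a" where
  "lie_exp G v =
     (THE g. \<exists>\<gamma>. one_parameter_subgroup G \<gamma> \<and> (\<gamma> has_vector_derivative v) (at 0) \<and> \<gamma> 1 = g)"

text \<open>Points of \<open>G/\<Gamma>\<close> are left cosets, i.e. sets of group elements, on which \<open>G\<close> acts by \<open><#\<close>.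
  Only the values of \<open>c\<close> on \<open>[0,1]\<close> are relevant.\<close>

definition connecting_curve ::
    "('a::real_normed_vector, 'b) monoid_scheme \<Rightarrow> 'a set \<Rightarrow> 'a set \<Rightarrow> (real \<Rightarrow> 'a set) \<Rightarrow> bool" where
  "connecting_curve G m\<^sub>1 m\<^sub>2 c \<longleftrightarrow>
     (\<exists>v. \<forall>t\<in>{0..1}. c t = lie_exp G (t *\<^sub>R v) <#\<^bsub>G\<^esub> m\<^sub>1) \<and> c 0 = m\<^sub>1 \<and> c 1 = m\<^sub>2"

definition blocking_set ::
    "('a::real_normed_vector, 'b) monoid_scheme \<Rightarrow> 'a set \<Rightarrow> 'a set \<Rightarrow> 'a set \<Rightarrow> 'a set set \<Rightarrow> bool" where
  "blocking_set G \<Gamma> m\<^sub>1 m\<^sub>2 B \<longleftrightarrow>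
     finite B \<and> B \<subseteq> (lcosets\<^bsub>G\<^esub> \<Gamma>) - {m\<^sub>1, m\<^sub>2} \<and>
     (\<forall>c. connecting_curve G m\<^sub>1 m\<^sub>2 c \<longrightarrow> c ` {0..1} \<inter> B \<noteq> {})"

definition blockable ::
    "('a::real_normed_vector, 'b) monoid_scheme \<Rightarrow> 'a set \<Rightarrow> 'a set \<Rightarrow> 'a set \<Rightarrow> bool" where
  "blockable G \<Gamma> m\<^sub>1 m\<^sub>2 \<longleftrightarrow> (\<exists>B. blocking_set G \<Gamma> m\<^sub>1 m\<^sub>2 B)"


section \<open>The group Sol and its lattices\<close>

definition Sol :: "((real^2) \<times> real) monoid" where
  "Sol = \<lparr>carrier = UNIV,
          mult = (\<lambda>(v, z) (w, u). (vector [v$1 + exp z * w$1, v$2 + exp (- z) * w$2], z + u)),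
          one = (0, 0)\<rparr>"

text \<open>This set is a subgroup (indeed a lattice) only for suitable \<open>s\<close> and \<open>P\<close>, e.g. when
  \<open>P A P\<^sup>-\<^sup>1 = \<plusminus> diag (exp s, exp (- s))\<close> for some integer matrix \<open>A\<close> of determinant 1.\<close>

definition sol_lattice :: "real \<Rightarrow> real^2^2 \<Rightarrow> ((real^2) \<times> real) set" where
  "sol_lattice s P =
     {(P *v vector [of_int p, of_int q], s * of_int r) | p q r :: int. True}"

definition eigenvalue :: "real^'n^'n \<Rightarrow> real \<Rightarrow> bool" where
  "eigenvalue M \<mu> \<longleftrightarrow> (\<exists>v. v \<noteq> 0 \<and> M *v v = \<mu> *s v)"


section \<open>Sol is a group with a well-defined exponential map\<close>

lemma Sol_simps [simp]:
  "carrier Sol = UNIV"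
  "\<one>\<^bsub>Sol\<^esub> = (0, 0)"
  "(v, z) \<otimes>\<^bsub>Sol\<^esub> (w, u) = (vector [v$1 + exp z * w$1, v$2 + exp (- z) * w$2], z + u)"
  by (simp_all add: Sol_def)

lemma vec2_eq_iff: "(v :: real^2) = w \<longleftrightarrow> v$1 = w$1 \<and> v$2 = w$2"
  by (simp add: vec_eq_iff forall_2)

lemma group_Sol: "group Sol"
proof (rule groupI)
  fix g h k :: "(real^2) \<times> real"
  show "g \<otimes>\<^bsub>Sol\<^esub> h \<otimes>\<^bsub>Sol\<^esub> k = g \<otimes>\<^bsub>Sol\<^esub> (h \<otimes>\<^bsub>Sol\<^esub> k)"
    by (cases g; cases h; cases k) (simp add: vec2_eq_iff algebra_simps exp_add exp_minus exp_diff
        divide_inverse)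
next
  fix g :: "(real^2) \<times> real"
  show "\<one>\<^bsub>Sol\<^esub> \<otimes>\<^bsub>Sol\<^esub> g = g"
    by (cases g) (simp add: vec2_eq_iff)
next
  fix g :: "(real^2) \<times> real"
  obtain v z where g: "g = (v, z)"
    by (cases g)
  have "(vector [- exp (- z) * v$1, - exp z * v$2], - z) \<otimes>\<^bsub>Sol\<^esub> g = \<one>\<^bsub>Sol\<^esub>"
    by (simp add: g vec2_eq_iff)
  then show "\<exists>h\<in>carrier Sol. h \<otimes>\<^bsub>Sol\<^esub> g = \<one>\<^bsub>Sol\<^esub>"
    by (metis Sol_simps(1) UNIV_I)
qed auto

definition exp_primitive :: "real \<Rightarrow> real \<Rightarrow> real" where
  "exp_primitive c t = (if c = 0 then t else (exp (c * t) - 1) / c)"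

lemma exp_primitive_0 [simp]: "exp_primitive c 0 = 0"
  by (simp add: exp_primitive_def)

lemma exp_primitive_deriv: "(exp_primitive c has_vector_derivative exp (c * t)) (at t)"
proof (cases "c = 0")
  case True
  then have "exp_primitive c = (\<lambda>t. t)"
    by (simp add: exp_primitive_def fun_eq_iff)
  with True show ?thesis
    by (auto intro!: derivative_eq_intros)
next
  case False
  then have "exp_primitive c = (\<lambda>t. (exp (c * t) - 1) / c)"
    by (simp add: exp_primitive_def fun_eq_iff)
  with False show ?thesis
    by (auto intro!: derivative_eq_intros
        simp: has_real_derivative_iff_has_vector_derivative [symmetric])
qed

lemma exp_primitive_add:
  "exp_primitive c (t + u) = exp_primitive c t + exp (c * t) * exp_primitive c u"
  by (simp add: exp_primitive_def field_simps exp_add)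

lemma twisted_additive_unique:
  fixes f :: "real \<Rightarrow> real"
  assumes hom: "\<And>t u. f (t + u) = f t + exp (c * t) * f u"
    and d: "(f has_vector_derivative a) (at 0)"
  shows "f t = a * exp_primitive c t"
proof -
  have f0: "f 0 = 0"
    using hom [of 0 0] by simp
  have "((\<lambda>x. f x - a * exp_primitive c x) has_field_derivative 0) (at t)" for t
  proof -
    have "((\<lambda>x. f (x - t)) has_field_derivative a) (at t)"
      using d DERIV_shift [of "\<lambda>x. f (x - t)" a 0 t]
      by (simp add: has_real_derivative_iff_has_vector_derivative)
    then have "((\<lambda>x. f t + exp (c * t) * f (x - t)) has_field_derivative exp (c * t) * a) (at t)"
      by (auto intro!: derivative_eq_intros)
    also have "(\<lambda>x. f t + exp (c * t) * f (x - t)) = f"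
    proof
      fix x
      show "f t + exp (c * t) * f (x - t) = f x"
        using hom [of t "x - t"] by simp
    qed
    finally have 1: "(f has_field_derivative exp (c * t) * a) (at t)" .
    have 2: "(exp_primitive c has_field_derivative exp (c * t)) (at t)"
      using exp_primitive_deriv has_real_derivative_iff_has_vector_derivative by blast
    show ?thesis
      using 1 2 by (auto intro!: derivative_eq_intros)
  qed
  then have "f t - a * exp_primitive c t = f 0 - a * exp_primitive c 0"
    by (intro DERIV_isconst_all) auto
  then show ?thesis
    by (simp add: f0)
qed

definition sol_curve :: "(real^2) \<times> real \<Rightarrow> real \<Rightarrow> (real^2) \<times> real" where
  "sol_curve X t =
     (vector [fst X $ 1 * exp_primitive (snd X) t, fst X $ 2 * exp_primitive (- snd X) t],
      snd X * t)"

lemma vector_2_axis: "(vector [a, b] :: real^2) = a *\<^sub>R axis 1 1 + b *\<^sub>R axis 2 1"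
  by (simp add: vec2_eq_iff axis_def)

lemma sol_curve_deriv:
  "(sol_curve X has_vector_derivative
     (vector [fst X $ 1 * exp (snd X * t), fst X $ 2 * exp (- snd X * t)], snd X)) (at t)"
proof -
  have d: "((\<lambda>t. a * exp_primitive c t) has_vector_derivative a * exp (c * t)) (at t)" for a c
    using exp_primitive_deriv [of c t]
    by (auto intro!: derivative_eq_intros
        simp: has_real_derivative_iff_has_vector_derivative [symmetric])
  have l: "((\<lambda>t. snd X * t) has_vector_derivative snd X) (at t)"
    by (auto intro!: derivative_eq_intros
        simp: has_real_derivative_iff_has_vector_derivative [symmetric])
  have s: "((\<lambda>t. f t *\<^sub>R v) has_vector_derivative f' *\<^sub>R v) (at t)"
    if "(f has_vector_derivative f') (at t)" for f f' and v :: "real^2"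
    using bounded_linear.has_vector_derivative [OF bounded_linear_scaleR_left that] .
  show ?thesis
    unfolding sol_curve_def [abs_def] vector_2_axis
    by (intro has_vector_derivative_Pair has_vector_derivative_add s d l)
qed

lemma one_parameter_subgroup_Sol:
  "one_parameter_subgroup Sol (sol_curve X) \<and> (sol_curve X has_vector_derivative X) (at 0)"
proof
  show "one_parameter_subgroup Sol (sol_curve X)"
    unfolding one_parameter_subgroup_def
  proof (intro conjI allI)
    show "sol_curve X (t + u) = sol_curve X t \<otimes>\<^bsub>Sol\<^esub> sol_curve X u" for t u
      by (simp add: sol_curve_def vec2_eq_iff exp_primitive_add algebra_simps)
    show "sol_curve X differentiable_on UNIV"
      by (meson differentiableI_vector differentiable_at_imp_differentiable_on sol_curve_deriv)
  qed auto
  have "(vector [fst X $ 1 * exp (snd X * 0), fst X $ 2 * exp (- snd X * 0)], snd X) = X"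
    by (simp add: prod_eq_iff vec2_eq_iff)
  then show "(sol_curve X has_vector_derivative X) (at 0)"
    using sol_curve_deriv [of X 0] by metis
qed

lemma one_parameter_subgroup_Sol_unique:
  assumes "one_parameter_subgroup Sol \<gamma>" "(\<gamma> has_vector_derivative X) (at 0)"
  shows "\<gamma> = sol_curve X"
proof
  fix t
  have hom: "\<gamma> (t + u) = \<gamma> t \<otimes>\<^bsub>Sol\<^esub> \<gamma> u" for t u
    using assms(1) by (auto simp: one_parameter_subgroup_def)
  have hom_z: "snd (\<gamma> (t + u)) = snd (\<gamma> t) + snd (\<gamma> u)" for t u
    by (simp add: hom) (cases "\<gamma> t"; cases "\<gamma> u"; simp)
  have dz: "((\<lambda>t. snd (\<gamma> t)) has_vector_derivative snd X) (at 0)"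
    using bounded_linear.has_vector_derivative [OF bounded_linear_snd assms(2)] .
  have dv: "((\<lambda>t. fst (\<gamma> t) $ i) has_vector_derivative fst X $ i) (at 0)" for i
    using bounded_linear.has_vector_derivative [OF bounded_linear_vec_nth
        bounded_linear.has_vector_derivative [OF bounded_linear_fst assms(2)]] .
  have z: "snd (\<gamma> t) = snd X * t" for t
    using twisted_additive_unique [of "\<lambda>t. snd (\<gamma> t)" 0, OF _ dz] hom_z
    by (simp add: exp_primitive_def)
  have hom_x: "fst (\<gamma> (t + u)) $ 1 = fst (\<gamma> t) $ 1 + exp (snd X * t) * fst (\<gamma> u) $ 1"
    and hom_y: "fst (\<gamma> (t + u)) $ 2 = fst (\<gamma> t) $ 2 + exp (- snd X * t) * fst (\<gamma> u) $ 2"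
    for t u
    using z [of t] by (simp_all add: hom) (cases "\<gamma> t"; cases "\<gamma> u"; simp)+
  show "\<gamma> t = sol_curve X t"
    using twisted_additive_unique [OF hom_x dv] twisted_additive_unique [OF hom_y dv] z [of t]
    by (simp add: sol_curve_def prod_eq_iff vec2_eq_iff)
qed

lemma lie_exp_Sol: "lie_exp Sol X = sol_curve X 1"
  unfolding lie_exp_def
  using one_parameter_subgroup_Sol one_parameter_subgroup_Sol_unique by (intro the_equality) blast+

end

theory Submission
  imports Defs
begin

text \<open>
  Translating by \<open>g\<^sub>1\<close>, consider the curves from the identity to \<open>(0, y, Z)\<close> with
  \<open>Z = z + s r\<close> and \<open>Z \<rightarrow> \<infinity>\<close>: their points are \<open>(0, y (1 - exp (- t Z)) / (1 - exp (- Z)), t Z)\<close>.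
  A nonzero lattice vector \<open>P (p, q)\<close> has nonzero coordinates, because \<open>\<lambda>\<close> is irrational. So if
  two such points lie in the same coset, they differ by some \<open>(0, 0, s k)\<close> and the quotient
  \<open>(1 - exp (- t Z)) / (1 - exp (- Z))\<close> has the same value \<open>\<kappa>\<close> for both. As
  \<open>0 < \<kappa> < 1\<close> for interior points, \<open>t Z \<le> - ln (1 - \<kappa>)\<close>; this leaves finitely many values of
  \<open>k\<close>, and \<open>k\<close> determines \<open>Z\<close>. Hence each point of \<open>Sol/\<Gamma>\<close> blocks only finitely many of these
  curves. The case \<open>y = 0\<close> is the same with \<open>Z \<rightarrow> -\<infinity>\<close>.
\<close>

section \<open>Coordinates, exponential and logarithm in Sol\<close>

text \<open>Height \<open>z\<close> scales coordinate \<open>i\<close> by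
  \<open>exp (twist i * z)\<close>. Having one formula for both horizontal coordinates lets the
  cases \<open>x = 0\<close> and \<open>y = 0\<close> share one proof.\<close>

definition twist :: "2 \<Rightarrow> real" where
  "twist i = (if i = 1 then 1 else - 1)"

lemma Sol_mult_nth:
  "fst (g \<otimes>\<^bsub>Sol\<^esub> h) $ i = fst g $ i + exp (twist i * snd g) * fst h $ i"
  using exhaust_2 [of i] by (cases g; cases h) (auto simp: twist_def)

lemma snd_Sol_mult: "snd (g \<otimes>\<^bsub>Sol\<^esub> h) = snd g + snd h"
  by (cases g; cases h) simp

lemma Sol_eqI:
  assumes "\<And>i. fst g $ i = fst h $ i" "snd g = snd h"
  shows "g = (h :: (real^2) \<times> real)"
  using assms by (simp add: prod_eq_iff vec_eq_iff)

lemma sol_curve_nth: "fst (sol_curve X t) $ i = fst X $ i * exp_primitive (twist i * snd X) t"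
  using exhaust_2 [of i] by (auto simp: twist_def sol_curve_def)

lemma snd_sol_curve [simp]: "snd (sol_curve X t) = snd X * t"
  by (simp add: sol_curve_def)

lemma sol_curve_0: "sol_curve X 0 = \<one>\<^bsub>Sol\<^esub>"
  by (rule Sol_eqI) (simp_all add: sol_curve_nth)

lemma exp_primitive_scale: "t * exp_primitive (t * c) 1 = exp_primitive c t"
  by (auto simp: exp_primitive_def mult.commute)

lemma lie_exp_Sol_scaleR: "lie_exp Sol (t *\<^sub>R X) = sol_curve X t"
proof (rule Sol_eqI)
  fix i
  have "fst X $ i * (t * exp_primitive (t * (twist i * snd X)) 1)
      = fst X $ i * exp_primitive (twist i * snd X) t"
    by (simp only: exp_primitive_scale)
  then show "fst (lie_exp Sol (t *\<^sub>R X)) $ i = fst (sol_curve X t) $ i"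
    by (simp add: lie_exp_Sol sol_curve_nth mult_ac)
qed (simp add: lie_exp_Sol)

lemma exp_primitive_mult: "c * exp_primitive c t = exp (c * t) - 1"
  by (simp add: exp_primitive_def)

lemma exp_primitive_neq_0: "t \<noteq> 0 \<Longrightarrow> exp_primitive c t \<noteq> 0"
  by (simp add: exp_primitive_def)

text \<open>This is the time profile of a horizontal coordinate, normalised to 1 at time 1. For
  \<open>c > 0\<close> the right side shows that it lies strictly between 0 and 1 at interior
  times.\<close>

lemma exp_primitive_ratio:
  assumes "c \<noteq> 0"
  shows "exp_primitive (- c) t / exp_primitive (- c) 1 = (1 - exp (- (c * t))) / (1 - exp (- c))"
  using assms by (simp add: exp_primitive_def divide_simps) (simp add: algebra_simps)

text \<open>Conjugation by \<open>g\<close> carries one-parameter subgroups to one-parameter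
  subgroups. Connecting curves multiply \<open>g\<close> from the left; this turns them into curves
  from the identity, translated by \<open>g\<close>.\<close>

lemma sol_curve_conjugate:
  "\<exists>X'. \<forall>t. sol_curve X' t \<otimes>\<^bsub>Sol\<^esub> g = g \<otimes>\<^bsub>Sol\<^esub> sol_curve X t"
proof -
  \<comment> \<open>\<open>X'\<close> is the adjoint action of \<open>g\<close> on \<open>X\<close>,
    that is, the initial velocity of the conjugated curve.\<close>
  define X' :: "(real^2) \<times> real" where
    "X' = (\<chi> i. exp (twist i * snd g) * fst X $ i - twist i * snd X * fst g $ i, snd X)"
  have "sol_curve X' t \<otimes>\<^bsub>Sol\<^esub> g = g \<otimes>\<^bsub>Sol\<^esub> sol_curve X t" for t
  proof (rule Sol_eqI)
    fix i
    have "exp (twist i * (snd X * t))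
        = 1 + twist i * snd X * exp_primitive (twist i * snd X) t"
      by (simp add: exp_primitive_mult mult.assoc)
    then show "fst (sol_curve X' t \<otimes>\<^bsub>Sol\<^esub> g) $ i = fst (g \<otimes>\<^bsub>Sol\<^esub> sol_curve X t) $ i"
      by (simp add: Sol_mult_nth sol_curve_nth X'_def algebra_simps)
  qed (simp add: snd_Sol_mult X'_def)
  then show ?thesis
    by blast
qed

text \<open>A logarithm for Sol. \<open>exp_primitive c 1\<close> vanishes for no \<open>c\<close>,
  so the quotient is meaningful at every point, height zero included.\<close>

definition sol_log :: "(real^2) \<times> real \<Rightarrow> (real^2) \<times> real" where
  "sol_log h = (\<chi> i. fst h $ i / exp_primitive (twist i * snd h) 1, snd h)"

lemma sol_log_nth [simp]: "fst (sol_log h) $ i = fst h $ i / exp_primitive (twist i * snd h) 1"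
  and snd_sol_log [simp]: "snd (sol_log h) = snd h"
  by (simp_all add: sol_log_def)

lemma sol_curve_sol_log: "sol_curve (sol_log h) 1 = h"
  by (rule Sol_eqI) (simp_all add: sol_curve_nth exp_primitive_neq_0)

text \<open>Each representative \<open>h\<close> of the target, taken relative to \<open>g\<close>,
  yields its own curve; this freedom supplies infinitely many of them.\<close>

lemma connecting_curve_Sol:
  assumes "(g \<otimes>\<^bsub>Sol\<^esub> h) <#\<^bsub>Sol\<^esub> \<Gamma> = m"
  shows "connecting_curve Sol (g <#\<^bsub>Sol\<^esub> \<Gamma>) m
           (\<lambda>t. (g \<otimes>\<^bsub>Sol\<^esub> sol_curve (sol_log h) t) <#\<^bsub>Sol\<^esub> \<Gamma>)"
proof -
  interpret group Sol
    by (rule group_Sol)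
  obtain X where X: "sol_curve X t \<otimes>\<^bsub>Sol\<^esub> g = g \<otimes>\<^bsub>Sol\<^esub> sol_curve (sol_log h) t" for t
    using sol_curve_conjugate by metis
  have "lie_exp Sol (t *\<^sub>R X) <#\<^bsub>Sol\<^esub> (g <#\<^bsub>Sol\<^esub> \<Gamma>)
      = (g \<otimes>\<^bsub>Sol\<^esub> sol_curve (sol_log h) t) <#\<^bsub>Sol\<^esub> \<Gamma>" for t
    by (simp add: lie_exp_Sol_scaleR lcos_m_assoc flip: X)
  moreover have "g \<otimes>\<^bsub>Sol\<^esub> sol_curve (sol_log h) 0 = g"
    unfolding sol_curve_0 by (rule r_one) simp
  ultimately show ?thesis
    unfolding connecting_curve_def sol_curve_sol_log using assms by (simp only:) blast
qed

section \<open>Finiteness of the parameters on a common level\<close>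

lemma finite_bounded_progression:
  fixes a b u :: real
  assumes "u \<noteq> 0"
  shows "finite {k::int. \<bar>a + u * of_int k\<bar> \<le> b}"
proof (rule finite_subset)
  show "{k::int. \<bar>a + u * of_int k\<bar> \<le> b} \<subseteq> {- \<lceil>(b + \<bar>a\<bar>) / \<bar>u\<bar>\<rceil> .. \<lceil>(b + \<bar>a\<bar>) / \<bar>u\<bar>\<rceil>}"
  proof
    fix k :: int
    assume "k \<in> {k. \<bar>a + u * of_int k\<bar> \<le> b}"
    then have "\<bar>u * real_of_int k\<bar> \<le> b + \<bar>a\<bar>"
      by (simp only: mem_Collect_eq)
    then have "\<bar>u\<bar> * \<bar>real_of_int k\<bar> \<le> b + \<bar>a\<bar>"
      by (simp only: abs_mult)
    then have "\<bar>real_of_int k\<bar> \<le> (b + \<bar>a\<bar>) / \<bar>u\<bar>"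
      using assms by (simp add: field_simps)
    also have "\<dots> \<le> \<lceil>(b + \<bar>a\<bar>) / \<bar>u\<bar>\<rceil>"
      by simp
    finally have "\<bar>k\<bar> \<le> \<lceil>(b + \<bar>a\<bar>) / \<bar>u\<bar>\<rceil>"
      by (simp only: of_int_le_iff flip: of_int_abs)
    then show "k \<in> {- \<lceil>(b + \<bar>a\<bar>) / \<bar>u\<bar>\<rceil> .. \<lceil>(b + \<bar>a\<bar>) / \<bar>u\<bar>\<rceil>}"
      by (simp only: atLeastAtMost_iff) arith
  qed
qed auto

lemma finite_interior_level:
  fixes Z :: "nat \<Rightarrow> real"
  assumes "inj Z" "u \<noteq> 0" "0 < \<kappa>" "\<kappa> < 1"
  shows "finite {r. 0 < Z r \<and> (\<exists>t\<in>{0<..<1}. \<exists>k::int.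
            1 - exp (- (Z r * t)) = \<kappa> * (1 - exp (- Z r)) \<and> Z r * t = a + u * of_int k)}"
    (is "finite ?R")
proof -
  define K where "K = {k::int. \<bar>a + u * of_int k\<bar> \<le> - ln (1 - \<kappa>)}"
  \<comment> \<open>The level equation solved for \<open>Z r\<close>, with
    \<open>a + u * of_int k\<close> in place of \<open>Z r * t\<close>.\<close>
  define f where "f k = - ln (1 - (1 - exp (- (a + u * of_int k))) / \<kappa>)" for k :: int
  have "Z ` ?R \<subseteq> f ` K"
  proof safe
    fix r t k
    assume Z: "0 < Z r" and t: "t \<in> {0<..<1}"
      and e: "1 - exp (- (Z r * t)) = \<kappa> * (1 - exp (- Z r))"
      and k: "Z r * t = a + u * of_int k"
    \<comment> \<open>By \<open>e\<close>, the right side exceeds the left by the positive term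
      \<open>\<kappa> * exp (- Z r)\<close>.\<close>
    have "1 - \<kappa> \<le> exp (- (Z r * t))"
      using e mult_pos_pos [OF assms(3) exp_gt_zero [of "- Z r"]] by (simp add: algebra_simps)
    then have "ln (1 - \<kappa>) \<le> ln (exp (- (Z r * t)))"
      using assms(4) by (subst ln_le_cancel_iff) simp_all
    then have "ln (1 - \<kappa>) \<le> - (Z r * t)"
      by (simp only: ln_exp)
    moreover have "0 < Z r * t"
      using Z t by simp
    ultimately have "\<bar>Z r * t\<bar> \<le> - ln (1 - \<kappa>)"
      by linarith
    then have "k \<in> K"
      unfolding K_def k by simp
    have "(1 - exp (- (Z r * t))) / \<kappa> = 1 - exp (- Z r)"
      using assms(3) by (simp add: e)
    then have "f k = Z r"
      unfolding f_def k [symmetric] by simp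
    with \<open>k \<in> K\<close> show "Z r \<in> f ` K"
      by (metis imageI)
  qed
  moreover have "finite K"
    unfolding K_def using assms(2) by (rule finite_bounded_progression)
  ultimately have "finite (Z ` ?R)"
    by (rule finite_subset [OF _ finite_imageI])
  then show ?thesis
    by (rule finite_imageD) (rule inj_on_subset [OF assms(1) subset_UNIV])
qed

section \<open>Cosets of the lattice and its vertical translations\<close>

lemma zero_in_sol_lattice: "(0, 0) \<in> sol_lattice s P"
proof -
  have "(0, 0) = (P *v vector [of_int 0, of_int 0], s * of_int 0)"
    by (simp add: prod_eq_iff vec2_eq_iff matrix_vector_mult_def sum_2)
  then show ?thesis
    unfolding sol_lattice_def by blast
qed

text \<open>The identity belongs to the lattice, so \<open>g\<close> lies in its own coset and hence
  in that of \<open>h\<close>.\<close>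

lemma sol_lattice_coset_eqD:
  assumes "g <#\<^bsub>Sol\<^esub> sol_lattice s P = h <#\<^bsub>Sol\<^esub> sol_lattice s P"
  obtains p q k :: int where "g = h \<otimes>\<^bsub>Sol\<^esub> (P *v vector [of_int p, of_int q], s * of_int k)"
proof -
  interpret group Sol
    by (rule group_Sol)
  have "g = g \<otimes>\<^bsub>Sol\<^esub> (0, 0)"
    using r_one [of g] by (simp del: r_one)
  then have "g \<in> g <#\<^bsub>Sol\<^esub> sol_lattice s P"
    using zero_in_sol_lattice unfolding l_coset_def by blast
  then show ?thesis
    using that unfolding assms by (auto simp: l_coset_def sol_lattice_def)
qed

text \<open>The automorphism of the plane by which height \<open>s\<close> acts in Sol.\<close>

definition sol_diag :: "real \<Rightarrow> real^2^2" where
  "sol_diag s = vector [vector [exp s, 0], vector [0, exp (- s)]]"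

lemma vertical_Sol_mult: "(0, z) \<otimes>\<^bsub>Sol\<^esub> (v, u) = (sol_diag z *v v, z + u)"
  by (simp add: vec2_eq_iff matrix_vector_mult_def sum_2 sol_diag_def)

lemma sol_diag_add: "sol_diag (s + t) = sol_diag s ** sol_diag t"
  by (simp add: sol_diag_def vec_eq_iff forall_2 matrix_matrix_mult_def sum_2 exp_add exp_diff
      exp_minus divide_inverse)

lemma int_vector_mult:
  fixes A :: "int^2^2"
  shows "map_matrix real_of_int A *v vector [of_int p, of_int q]
     = vector [of_int (A$1$1 * p + A$1$2 * q), of_int (A$2$1 * p + A$2$2 * q)]"
  by (simp add: vec2_eq_iff matrix_vector_mult_def sum_2 map_matrix_def)

text \<open>The intertwining relation trades the scaling of a lattice vector for an integer matrix
  acting on \<open>(p, q)\<close>. General \<open>t\<close> and \<open>r\<close> cover both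
  \<open>A\<close> at height \<open>s\<close> and its inverse at height \<open>- s\<close>.\<close>

lemma sol_lattice_vertical_mem:
  fixes A :: "int^2^2"
  assumes "P ** map_matrix real_of_int A = sol_diag t ** P" "t = s * of_int r"
    and "g \<in> sol_lattice s P"
  shows "(0, t) \<otimes>\<^bsub>Sol\<^esub> g \<in> sol_lattice s P"
proof -
  obtain p q k :: int where g: "g = (P *v vector [of_int p, of_int q], s * of_int k)"
    using assms(3) by (auto simp: sol_lattice_def)
  have "sol_diag t *v (P *v vector [of_int p, of_int q])
      = P *v (map_matrix real_of_int A *v vector [of_int p, of_int q])"
    by (simp add: matrix_vector_mul_assoc assms(1))
  moreover have "t + s * of_int k = s * of_int (r + k)"
    by (simp add: assms(2) algebra_simps)
  ultimately show ?thesis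
    unfolding g vertical_Sol_mult int_vector_mult sol_lattice_def by blast
qed

text \<open>Determinant 1 makes the adjugate an integer inverse of \<open>A\<close>, and inverting
  both sides of the relation reverses the sign of \<open>s\<close>.\<close>

lemma sol_lattice_adjugate:
  fixes A :: "int^2^2"
  assumes "P ** map_matrix real_of_int A = sol_diag s ** P" "det A = 1"
  shows "\<exists>A'::int^2^2. P ** map_matrix real_of_int A' = sol_diag (- s) ** P"
proof -
  define A' :: "int^2^2" where "A' = vector [vector [A$2$2, - A$1$2], vector [- A$2$1, A$1$1]]"
  have d: "A$1$1 * A$2$2 - A$1$2 * A$2$1 = 1"
    using assms(2) by (simp add: det_2)
  then have d': "real_of_int (A$1$1) * A$2$2 - real_of_int (A$1$2) * A$2$1 = 1"
    by (metis of_int_1 of_int_diff of_int_mult)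
  have "map_matrix real_of_int A ** map_matrix real_of_int A' = mat 1"
    using d' by (simp add: A'_def vec_eq_iff forall_2 matrix_matrix_mult_def sum_2 map_matrix_def
        mat_def algebra_simps)
  then have "P = sol_diag s ** P ** map_matrix real_of_int A'"
    by (metis assms(1) matrix_mul_assoc matrix_mul_rid)
  then have "sol_diag (- s) ** P = sol_diag (- s) ** (sol_diag s ** P ** map_matrix real_of_int A')"
    by simp
  also have "\<dots> = sol_diag (- s + s) ** P ** map_matrix real_of_int A'"
    by (simp only: sol_diag_add matrix_mul_assoc)
  also have "sol_diag (- s + s) = mat 1"
    by (simp add: sol_diag_def vec_eq_iff forall_2 mat_def)
  finally show ?thesis
    by (metis matrix_mul_lid)
qed

text \<open>Two-sided induction from 0: \<open>A\<close> drives the upward step, its inverse the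
  downward one.\<close>

lemma sol_lattice_vertical_iterate:
  fixes A :: "int^2^2"
  assumes "P ** map_matrix real_of_int A = sol_diag s ** P" "det A = 1"
    and "g \<in> sol_lattice s P"
  shows "(0, s * of_int r) \<otimes>\<^bsub>Sol\<^esub> g \<in> sol_lattice s P"
proof -
  interpret group Sol
    by (rule group_Sol)
  have step: "(0, s * of_int (k + d)) \<otimes>\<^bsub>Sol\<^esub> g
      = (0, s * of_int d) \<otimes>\<^bsub>Sol\<^esub> ((0, s * of_int k) \<otimes>\<^bsub>Sol\<^esub> g)" for k d :: int
  proof -
    have "(0, s * of_int (k + d)) = (0, s * of_int d) \<otimes>\<^bsub>Sol\<^esub> (0, s * of_int k)"
      by (simp add: vec2_eq_iff algebra_simps)
    then show ?thesis
      by (metis m_assoc UNIV_I Sol_simps(1))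
  qed
  obtain A' :: "int^2^2" where A': "P ** map_matrix real_of_int A' = sol_diag (- s) ** P"
    using sol_lattice_adjugate assms by blast
  show ?thesis
  proof (induction r rule: int_induct [where k = 0])
    case base
    have "(0, s * of_int 0) \<otimes>\<^bsub>Sol\<^esub> g = g"
      using l_one [of g] by simp
    with assms(3) show ?case
      by metis
  next
    case (step1 i)
    show ?case
      unfolding step
      by (rule sol_lattice_vertical_mem [where A = A and r = 1]) (simp_all add: assms(1) step1)
  next
    case (step2 i)
    show ?case
      unfolding diff_conv_add_uminus step
      by (rule sol_lattice_vertical_mem [where A = A' and r = "- 1"]) (simp_all add: A' step2)
  qed
qed

text \<open>A vertical translation by a multiple of \<open>s\<close> and its inverse both map the
  lattice into itself, so they preserve it. Hence the height of a representative can be shifted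
  within its coset.\<close>

lemma sol_lattice_vertical_coset:
  fixes A :: "int^2^2"
  assumes "P ** map_matrix real_of_int A = sol_diag s ** P" "det A = 1"
  shows "(g \<otimes>\<^bsub>Sol\<^esub> (0, s * of_int r)) <#\<^bsub>Sol\<^esub> sol_lattice s P = g <#\<^bsub>Sol\<^esub> sol_lattice s P"
proof -
  interpret group Sol
    by (rule group_Sol)
  have sub: "(0, s * of_int r) <#\<^bsub>Sol\<^esub> sol_lattice s P \<subseteq> sol_lattice s P" for r
    using sol_lattice_vertical_iterate [OF assms] by (auto simp: l_coset_def)
  have inv: "(0, s * of_int r) \<otimes>\<^bsub>Sol\<^esub> (0, s * of_int (- r)) = \<one>\<^bsub>Sol\<^esub>"
    by (simp add: vec2_eq_iff)
  have "sol_lattice s P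
      = (0, s * of_int r) <#\<^bsub>Sol\<^esub> ((0, s * of_int (- r)) <#\<^bsub>Sol\<^esub> sol_lattice s P)"
    by (subst lcos_m_assoc) (simp_all only: Sol_simps(1) subset_UNIV UNIV_I inv lcos_mult_one)
  also have "\<dots> \<subseteq> (0, s * of_int r) <#\<^bsub>Sol\<^esub> sol_lattice s P"
    using sub [of "- r"] by (auto simp: l_coset_def)
  finally have "(0, s * of_int r) <#\<^bsub>Sol\<^esub> sol_lattice s P = sol_lattice s P"
    using sub by blast
  then show ?thesis
    using lcos_m_assoc [of "sol_lattice s P" g "(0, s * of_int r)"] by simp
qed

section \<open>Irrational eigenvalues and nonvanishing lattice coordinates\<close>

text \<open>The rational root theorem: leading and constant coefficients are 1, so numerator and
  denominator in lowest terms divide each other's squares and are units.\<close>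

lemma rational_reciprocal_root:
  fixes \<mu> :: real
  assumes "\<mu> \<in> \<rat>" "\<mu>\<^sup>2 - of_int n * \<mu> + 1 = 0"
  shows "\<bar>\<mu>\<bar> = 1"
proof -
  obtain a b :: int where ab: "\<mu> = of_int a / of_int b" "0 < b" "coprime a b"
    using assms(1) by (rule Rats_cases')
  have "0 = (\<mu>\<^sup>2 - of_int n * \<mu> + 1) * (of_int b)\<^sup>2"
    by (simp only: assms(2) mult_zero_left)
  also have "\<dots> = (\<mu> * of_int b)\<^sup>2 - of_int n * (\<mu> * of_int b) * of_int b + (of_int b)\<^sup>2"
    by (simp add: algebra_simps power2_eq_square)
  also have "\<mu> * of_int b = of_int a"
    using ab(1,2) by simp
  finally have "real_of_int (a\<^sup>2 - n * a * b + b\<^sup>2) = 0"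
    by simp
  then have "a\<^sup>2 - n * a * b + b\<^sup>2 = 0"
    by (simp only: of_int_eq_0_iff)
  then have "a * a = b * (n * a - b)" "b * b = a * (n * b - a)"
    by (simp_all add: power2_eq_square algebra_simps)
  then have "b dvd a * a" "a dvd b * b"
    by (simp_all only: dvd_triv_left)
  moreover have "coprime b a"
    using ab(3) by (simp only: coprime_commute)
  ultimately have "b dvd a" "a dvd b"
    using ab(3) by (simp_all only: coprime_dvd_mult_left_iff)
  then have "is_unit a" "is_unit b"
    using coprime_common_divisor [OF ab(3) dvd_refl] coprime_common_divisor [OF ab(3) _ dvd_refl]
    by (simp_all only:)
  then have "\<bar>a\<bar> = 1" "\<bar>b\<bar> = 1"
    by (simp_all only: zdvd1_eq)
  then have "\<bar>real_of_int a\<bar> = 1" "\<bar>real_of_int b\<bar> = 1"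
    by (simp_all only: of_int_1 flip: of_int_abs)
  then show ?thesis
    by (simp add: ab(1))
qed

text \<open>Otherwise the off-diagonal entry in row \<open>i\<close> of \<open>P\<close> would be
  rational, the diagonal one being 1. The corresponding eigenvalue, \<open>exp s\<close> or
  \<open>exp (- s)\<close>, would then be a rational root of the characteristic polynomial and equal
  to 1.\<close>

lemma lattice_coordinate_neq_0:
  fixes A :: "int^2^2"
  assumes "s \<noteq> 0" "P ** map_matrix real_of_int A = sol_diag s ** P" "det A = 1"
    and "P $ 1 $ 1 = 1" "P $ 2 $ 2 = 1"
    and "(P *v vector [of_int p, of_int q]) $ i = 0"
  shows "p = 0 \<and> q = 0"
proof -
  let ?a = "\<lambda>i j. real_of_int (A $ i $ j)"
  have entries: "?a 1 1 + P$1$2 * ?a 2 1 = exp s" "?a 1 2 + P$1$2 * ?a 2 2 = exp s * P$1$2"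
    "P$2$1 * ?a 1 1 + ?a 2 1 = exp (- s) * P$2$1" "P$2$1 * ?a 1 2 + ?a 2 2 = exp (- s)"
    using assms(2,4,5)
    by (simp_all add: vec_eq_iff forall_2 matrix_matrix_mult_def sum_2 map_matrix_def sol_diag_def)
  have "A$1$1 * A$2$2 - A$1$2 * A$2$1 = 1"
    using assms(3) by (simp add: det_2)
  then have d: "?a 1 1 * ?a 2 2 - ?a 1 2 * ?a 2 1 = 1"
    by (metis of_int_1 of_int_diff of_int_mult)
  \<comment> \<open>The first two premises say that \<open>(1, \<rho>)\<close> is a left
    eigenvector, for \<open>\<mu>\<close>, of the matrix with rows \<open>(a, b)\<close> and
    \<open>(c, d)\<close>.\<close>
  have char_poly: "\<mu>\<^sup>2 - (a + d) * \<mu> + 1 = 0"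
    if "a + \<rho> * c = \<mu>" "b + \<rho> * d = \<mu> * \<rho>" "a * d - b * c = 1" for a b c d \<rho> \<mu> :: real
  proof -
    have "c * b + d * (\<mu> - a) = c * (b + \<rho> * d)"
      using that(1) by (simp add: algebra_simps flip: that(1))
    also have "\<dots> = \<mu> * (\<mu> - a)"
      unfolding that(2) by (simp add: algebra_simps flip: that(1))
    finally show ?thesis
      using that(3) by (simp add: algebra_simps power2_eq_square)
  qed
  have not_rat: "exp c \<notin> \<rat>" if "(exp c)\<^sup>2 - (?a 1 1 + ?a 2 2) * exp c + 1 = 0" "c \<noteq> 0" for c
    using rational_reciprocal_root [of "exp c" "A$1$1 + A$2$2"] that by auto
  have row: "p = 0 \<and> q = 0"
    if e: "of_int p + \<rho> * of_int q = 0" and \<rho>: "of_int m + \<rho> * of_int n = \<mu>" and \<mu>: "\<mu> \<notin> \<rat>"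
    for p q m n :: int and \<rho> \<mu> :: real
  proof (cases "q = 0")
    case True
    with e show ?thesis
      by simp
  next
    case False
    then have "\<rho> = - of_int p / of_int q"
      using e by (simp add: field_simps)
    then have "\<rho> \<in> \<rat>"
      by simp
    then have "\<mu> \<in> \<rat>"
      unfolding \<rho> [symmetric] by simp
    with \<mu> show ?thesis
      by simp
  qed
  consider "i = 1" | "i = 2"
    using exhaust_2 by blast
  then show ?thesis
  proof cases
    case 1
    have "(exp s)\<^sup>2 - (?a 1 1 + ?a 2 2) * exp s + 1 = 0"
      using char_poly entries(1,2) d by blast
    then have "exp s \<notin> \<rat>"
      using not_rat assms(1) by blast
    moreover have "of_int p + P$1$2 * of_int q = 0"
      using assms(4,6) 1 by (simp add: matrix_vector_mult_def sum_2)
    ultimately show ?thesis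
      using row entries(1) by blast
  next
    case 2
    \<comment> \<open>The 1 now stands second in the row of \<open>P\<close>, so
      \<open>char_poly\<close> and \<open>row\<close> are applied with the two coordinates
      swapped.\<close>
    have "(exp (- s))\<^sup>2 - (?a 1 1 + ?a 2 2) * exp (- s) + 1 = 0"
      using char_poly [of "?a 2 2" "P$2$1" "?a 1 2" "exp (- s)" "?a 2 1" "?a 1 1"] entries(3,4) d
      by (simp add: algebra_simps)
    then have "exp (- s) \<notin> \<rat>"
      using not_rat assms(1) by (metis neg_equal_0_iff_equal)
    moreover have "of_int q + P$2$1 * of_int p = 0"
      using assms(5,6) 2 by (simp add: matrix_vector_mult_def sum_2)
    moreover have "?a 2 2 + P$2$1 * ?a 1 2 = exp (- s)"
      using entries(4) by simp
    ultimately show ?thesis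
      using row by blast
  qed
qed

section \<open>Axis curves through a given coset\<close>

text \<open>The lattice vector joining the two points has vanishing coordinate \<open>i\<close>, so
  it is zero and only a vertical shift remains.\<close>

lemma axis_curve_coset_eqD:
  fixes A :: "int^2^2"
  assumes "s \<noteq> 0" "P ** map_matrix real_of_int A = sol_diag s ** P" "det A = 1"
    and "P $ 1 $ 1 = 1" "P $ 2 $ 2 = 1"
    and "g <#\<^bsub>Sol\<^esub> sol_lattice s P = h <#\<^bsub>Sol\<^esub> sol_lattice s P"
    and "fst g $ i = 0" "fst h $ i = 0"
  obtains k :: int where "fst g = fst h" "snd g = snd h + s * of_int k"
proof -
  obtain p q k :: int where g: "g = h \<otimes>\<^bsub>Sol\<^esub> (P *v vector [of_int p, of_int q], s * of_int k)"
    using sol_lattice_coset_eqD assms(6) by blast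
  have "(P *v vector [of_int p, of_int q]) $ i = 0"
    using assms(7,8) unfolding g Sol_mult_nth by simp
  then have "p = 0 \<and> q = 0"
    using lattice_coordinate_neq_0 assms(1-5) by blast
  then have "P *v vector [of_int p, of_int q] = 0"
    by (simp add: vec2_eq_iff matrix_vector_mult_def sum_2)
  then have "fst g = fst h" "snd g = snd h + s * of_int k"
    by (simp_all add: g vec_eq_iff Sol_mult_nth snd_Sol_mult)
  then show ?thesis
    using that by blast
qed

text \<open>The sign in \<open>snd (h r)\<close> makes the exponent in coordinate \<open>j\<close>
  equal to \<open>- Z r\<close> for either axis. All passages through \<open>b\<close> are compared
  with one reference passage, which reduces the claim to
  \<open>finite_interior_level\<close>.\<close>

lemma finite_blocked_axis_curves:
  fixes A :: "int^2^2" and h :: "nat \<Rightarrow> (real^2) \<times> real"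
  assumes "s \<noteq> 0" "P ** map_matrix real_of_int A = sol_diag s ** P" "det A = 1"
    and "P $ 1 $ 1 = 1" "P $ 2 $ 2 = 1"
    and "inj Z" and "\<And>r. snd (h r) = - twist j * Z r"
    and "\<And>r. fst (h r) = v" and "v $ i = 0" "v $ j \<noteq> 0"
  shows "finite {r. 0 < Z r \<and> (\<exists>t\<in>{0<..<1}.
           (g \<otimes>\<^bsub>Sol\<^esub> sol_curve (sol_log (h r)) t) <#\<^bsub>Sol\<^esub> sol_lattice s P = b)}"
    (is "finite ?R")
proof (cases "?R = {}")
  case True
  show ?thesis
    unfolding True by (rule finite.emptyI)
next
  case False
  interpret group Sol
    by (rule group_Sol)
  let ?W = "\<lambda>r. sol_curve (sol_log (h r))"
  let ?F = "\<lambda>r t. (1 - exp (- (Z r * t))) / (1 - exp (- Z r))"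
  obtain r\<^sub>0 t\<^sub>0 where 0: "0 < Z r\<^sub>0" "t\<^sub>0 \<in> {0<..<1}"
    "(g \<otimes>\<^bsub>Sol\<^esub> ?W r\<^sub>0 t\<^sub>0) <#\<^bsub>Sol\<^esub> sol_lattice s P = b"
    using False by blast
  have W_i: "fst (?W r t) $ i = 0" for r t
    using assms(8,9) by (simp add: sol_curve_nth)
  have tw: "twist j * twist j = 1"
    by (simp add: twist_def)
  have W_j: "fst (?W r t) $ j = v $ j * ?F r t" if "0 < Z r" for r t
  proof -
    have "twist j * snd (h r) = - Z r"
      using tw by (simp add: assms(7) flip: mult.assoc)
    then have "fst (?W r t) $ j = v $ j * (exp_primitive (- Z r) t / exp_primitive (- Z r) 1)"
      by (simp add: sol_curve_nth assms(8))
    with that exp_primitive_ratio [of "Z r" t] show ?thesis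
      by simp
  qed
  \<comment> \<open>The level of the reference passage; it is strictly between 0 and 1 because
    \<open>t\<^sub>0\<close> is interior.\<close>
  define \<kappa> where "\<kappa> = ?F r\<^sub>0 t\<^sub>0"
  have "0 < Z r\<^sub>0 * t\<^sub>0" "Z r\<^sub>0 * t\<^sub>0 < Z r\<^sub>0"
    using 0 by simp_all
  then have \<kappa>: "0 < \<kappa>" "\<kappa> < 1"
    using 0(1) by (simp_all add: \<kappa>_def)
  have "\<exists>k::int. 1 - exp (- (Z r * t)) = \<kappa> * (1 - exp (- Z r))
            \<and> Z r * t = Z r\<^sub>0 * t\<^sub>0 + (- twist j * s) * of_int k"
    if r: "0 < Z r" "(g \<otimes>\<^bsub>Sol\<^esub> ?W r t) <#\<^bsub>Sol\<^esub> sol_lattice s P = b" for r t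
  proof -
    have "inv\<^bsub>Sol\<^esub> g <#\<^bsub>Sol\<^esub> ((g \<otimes>\<^bsub>Sol\<^esub> ?W r t) <#\<^bsub>Sol\<^esub> sol_lattice s P)
        = inv\<^bsub>Sol\<^esub> g <#\<^bsub>Sol\<^esub> ((g \<otimes>\<^bsub>Sol\<^esub> ?W r\<^sub>0 t\<^sub>0) <#\<^bsub>Sol\<^esub> sol_lattice s P)"
      by (simp only: r(2) 0(3))
    then have "?W r t <#\<^bsub>Sol\<^esub> sol_lattice s P = ?W r\<^sub>0 t\<^sub>0 <#\<^bsub>Sol\<^esub> sol_lattice s P"
      by (simp add: lcos_m_assoc l_inv flip: m_assoc del: Sol_simps(2))
    then obtain k :: int where k: "fst (?W r t) = fst (?W r\<^sub>0 t\<^sub>0)"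
      "snd (?W r t) = snd (?W r\<^sub>0 t\<^sub>0) + s * of_int k"
      using axis_curve_coset_eqD [OF assms(1-5)] W_i by metis
    have "v $ j * ?F r t = v $ j * \<kappa>"
      unfolding \<kappa>_def W_j [OF r(1), symmetric] W_j [OF 0(1), symmetric] k(1) ..
    then have "?F r t = \<kappa>"
      by (rule mult_left_cancel [OF assms(10), THEN iffD1])
    then have "1 - exp (- (Z r * t)) = \<kappa> * (1 - exp (- Z r))"
      using r(1) by (simp add: field_simps)
    moreover have "Z r * t = Z r\<^sub>0 * t\<^sub>0 + (- twist j * s) * of_int k"
      using k(2) by (cases "j = 1") (simp_all add: assms(7) twist_def)
    ultimately show ?thesis
      by blast
  qed
  then have "?R \<subseteq> {r. 0 < Z r \<and> (\<exists>t\<in>{0<..<1}. \<exists>k::int.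
      1 - exp (- (Z r * t)) = \<kappa> * (1 - exp (- Z r))
      \<and> Z r * t = Z r\<^sub>0 * t\<^sub>0 + (- twist j * s) * of_int k)}"
    by blast
  moreover have "- twist j * s \<noteq> 0"
    using assms(1) by (simp add: twist_def)
  ultimately show ?thesis
    using finite_interior_level [OF assms(6) _ \<kappa>] by (meson finite_subset)
qed

section \<open>Infinitely many connecting curves against a finite blocking set\<close>

lemma not_blockable_axis:
  fixes A :: "int^2^2" and h :: "(real^2) \<times> real"
  assumes "s \<noteq> 0" "P ** map_matrix real_of_int A = sol_diag s ** P" "det A = 1"
    and "P $ 1 $ 1 = 1" "P $ 2 $ 2 = 1"
    and "fst h $ i = 0" "fst h $ j \<noteq> 0"
  shows "\<not> blockable Sol (sol_lattice s P) (g <#\<^bsub>Sol\<^esub> sol_lattice s P)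
           ((g \<otimes>\<^bsub>Sol\<^esub> h) <#\<^bsub>Sol\<^esub> sol_lattice s P)"
    (is "\<not> blockable _ ?\<Gamma> ?m ?m'")
proof
  interpret group Sol
    by (rule group_Sol)
  assume "blockable Sol ?\<Gamma> ?m ?m'"
  then obtain B where B: "finite B" "?m \<notin> B" "?m' \<notin> B"
    "\<And>c. connecting_curve Sol ?m ?m' c \<Longrightarrow> c ` {0..1} \<inter> B \<noteq> {}"
    unfolding blockable_def blocking_set_def by blast
  \<comment> \<open>The sign \<open>\<epsilon>\<close> makes the vertical steps go in the direction
    in which coordinate \<open>j\<close> contracts.\<close>
  have "\<exists>\<epsilon>::int. - twist j * \<bar>s\<bar> = s * of_int \<epsilon>"
  proof (cases "(j = 1) = (0 < s)")
    case True
    then have "- twist j * \<bar>s\<bar> = s * of_int (- 1)"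
      by (cases "0 < s") (simp_all add: twist_def)
    then show ?thesis ..
  next
    case False
    then have "- twist j * \<bar>s\<bar> = s * of_int 1"
      by (cases "0 < s") (simp_all add: twist_def)
    then show ?thesis ..
  qed
  then obtain \<epsilon> :: int where \<epsilon>: "- twist j * \<bar>s\<bar> = s * of_int \<epsilon>"
    by blast
  define Z where "Z r = - twist j * snd h + \<bar>s\<bar> * real r" for r
  \<comment> \<open>Multiplying on the right by a vertical lattice element keeps the horizontal part
    and the target coset, and changes the height alone.\<close>
  define H where "H r = h \<otimes>\<^bsub>Sol\<^esub> (0, s * of_int (\<epsilon> * int r))" for r
  have Z: "inj Z"
    using assms(1) by (auto simp: Z_def inj_def)
  have snd_H: "snd (H r) = - twist j * Z r" for r
  proof -
    have "s * of_int (\<epsilon> * int r) = - twist j * \<bar>s\<bar> * real r"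
      by (simp only: \<epsilon> of_int_mult of_int_of_nat_eq mult.assoc)
    then show ?thesis
      by (cases "j = 1") (simp_all add: H_def snd_Sol_mult Z_def twist_def)
  qed
  have fst_H: "fst (H r) = fst h" for r
    by (simp add: H_def vec_eq_iff Sol_mult_nth)
  let ?c = "\<lambda>r t. (g \<otimes>\<^bsub>Sol\<^esub> sol_curve (sol_log (H r)) t) <#\<^bsub>Sol\<^esub> ?\<Gamma>"
  let ?R = "\<lambda>b. {r. 0 < Z r \<and> (\<exists>t\<in>{0<..<1}. ?c r t = b)}"
  have "r \<in> (\<Union>b\<in>B. ?R b)" if r: "0 < Z r" for r
  proof -
    have "(g \<otimes>\<^bsub>Sol\<^esub> H r) <#\<^bsub>Sol\<^esub> ?\<Gamma> = ?m'"
      using sol_lattice_vertical_coset [OF assms(2,3), of "g \<otimes>\<^bsub>Sol\<^esub> h" "\<epsilon> * int r"]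
      by (simp add: H_def m_assoc del: Sol_simps(3))
    then have c: "connecting_curve Sol ?m ?m' (?c r)"
      by (rule connecting_curve_Sol)
    then obtain t where t: "t \<in> {0..1}" "?c r t \<in> B"
      using B(4) [OF c] by blast
    have "?c r 0 = ?m" "?c r 1 = ?m'"
      using c unfolding connecting_curve_def by (simp_all only:)
    then have "t \<noteq> 0" "t \<noteq> 1"
      using t(2) B(2,3) by metis+
    with t(1) have "t \<in> {0<..<1}"
      by simp
    with r t(2) show ?thesis
      by blast
  qed
  then have "{r. 0 < Z r} \<subseteq> (\<Union>b\<in>B. ?R b)"
    by blast
  moreover have "finite (\<Union>b\<in>B. ?R b)"
    by (intro finite_UN_I B(1) finite_blocked_axis_curves [OF assms(1-5) Z snd_H fst_H assms(6,7)])
  ultimately have "finite {r. 0 < Z r}"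
    by (rule finite_subset)
  then obtain N where N: "\<And>r. 0 < Z r \<Longrightarrow> r \<le> N"
    using finite_nat_set_iff_bounded_le by auto
  \<comment> \<open>In the index \<open>n + N + 1\<close>, the summand \<open>n\<close> makes
    \<open>Z\<close> positive and \<open>N + 1\<close> exceeds the bound \<open>N\<close>.\<close>
  obtain n where n: "\<bar>snd h\<bar> / \<bar>s\<bar> < real n"
    using reals_Archimedean2 by blast
  then have "\<bar>snd h\<bar> < \<bar>s\<bar> * real (n + N + 1)"
    using assms(1) by (simp add: field_simps add_strict_increasing2)
  then have "0 < Z (n + N + 1)"
    by (auto simp: Z_def twist_def)
  then show False
    using N by fastforce
qed

theorem theorem2:
  fixes s lam x y z :: real
    and A :: "int^2^2"
    and P :: "real^2^2"
    and \<Gamma> m\<^sub>1 m\<^sub>2 :: "((real^2) \<times> real) set"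
    and g\<^sub>1 g\<^sub>2 :: "(real^2) \<times> real"
  assumes "s \<noteq> 0"
    and "det A = 1"
    and "lam = exp s \<or> lam = - exp s"
    and "{\<mu>. eigenvalue (map_matrix real_of_int A) \<mu>} = {lam, inverse lam}"
    and "invertible P"
    and "P ** map_matrix real_of_int A ** matrix_inv P = vector [vector [lam, 0], vector [0, inverse lam]]"
    and "P $ 1 $ 1 = 1" and "P $ 2 $ 2 = 1"
    and "\<Gamma> = sol_lattice s P"
    and "g\<^sub>1 \<in> carrier Sol" and "g\<^sub>2 \<in> carrier Sol"
    and "m\<^sub>1 = g\<^sub>1 <#\<^bsub>Sol\<^esub> \<Gamma>" and "m\<^sub>2 = g\<^sub>2 <#\<^bsub>Sol\<^esub> \<Gamma>"
    and "inv\<^bsub>Sol\<^esub> g\<^sub>1 \<otimes>\<^bsub>Sol\<^esub> g\<^sub>2 = (vector [x, y], z)"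
    and "(x = 0 \<and> y \<noteq> 0) \<or> (y = 0 \<and> x \<noteq> 0)"
  shows "\<not> blockable Sol \<Gamma> m\<^sub>1 m\<^sub>2"
proof -
  interpret group Sol
    by (rule group_Sol)
  \<comment> \<open>The sign of \<open>lam\<close>. The lattice depends on \<open>s\<close> and
    \<open>P\<close> alone, so \<open>A\<close> may be replaced by \<open>\<delta>\<close> times
    \<open>A\<close>, whose determinant is still 1 in dimension two and whose diagonal form is
    \<open>sol_diag s\<close>.\<close>
  define \<delta> :: int where "\<delta> = (if lam = exp s then 1 else - 1)"
  have lam: "lam = of_int \<delta> * exp s" and \<delta>: "\<delta> * \<delta> = 1" "inverse (real_of_int \<delta>) = of_int \<delta>"
    using assms(3) by (auto simp: \<delta>_def)
  define A' :: "int^2^2" where "A' = (\<chi> i j. \<delta> * A $ i $ j)"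
  let ?D = "vector [vector [lam, 0], vector [0, inverse lam]] :: real^2^2"
  have "P ** matrix_inv P = mat 1 \<and> matrix_inv P ** P = mat 1"
    using assms(5) unfolding invertible_def matrix_inv_def by (rule someI_ex)
  then have PA: "P ** map_matrix real_of_int A = ?D ** P"
    unfolding assms(6) [symmetric] by (simp only: matrix_mul_rid flip: matrix_mul_assoc)
  have "P ** map_matrix real_of_int A' = of_int \<delta> *\<^sub>R (P ** map_matrix real_of_int A)"
    by (simp add: A'_def vec_eq_iff forall_2 matrix_matrix_mult_def sum_2 map_matrix_def
        algebra_simps)
  also have "\<dots> = of_int \<delta> *\<^sub>R (?D ** P)"
    by (simp only: PA)
  also have "\<dots> = sol_diag s ** P"
  proof -
    have "real_of_int \<delta> * of_int \<delta> = 1"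
      using \<delta>(1) by (metis of_int_1 of_int_mult)
    then show ?thesis
      by (simp add: vec_eq_iff forall_2 matrix_matrix_mult_def sum_2 sol_diag_def lam \<delta>(2)
          exp_minus flip: mult.assoc)
  qed
  finally have PA': "P ** map_matrix real_of_int A' = sol_diag s ** P" .
  have "det A' = (\<delta> * \<delta>) * det A"
    by (simp add: A'_def det_2 algebra_simps)
  then have det: "det A' = 1"
    using assms(2) \<delta>(1) by simp
  have g2: "g\<^sub>2 = g\<^sub>1 \<otimes>\<^bsub>Sol\<^esub> (vector [x, y], z)"
    unfolding assms(14) [symmetric] by (simp flip: m_assoc)
  obtain i j :: 2 where "fst (vector [x, y] :: real^2, z) $ i = 0"
    "fst (vector [x, y] :: real^2, z) $ j \<noteq> 0"
  proof (cases "x = 0")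
    case True
    then show ?thesis
      using assms(15) that [of 1 2] by simp
  next
    case False
    then show ?thesis
      using assms(15) that [of 2 1] by simp
  qed
  then show ?thesis
    unfolding assms(9,12,13) g2 by (intro not_blockable_axis [OF assms(1) PA' det assms(7,8)])
qed

end
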